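(* Let $\mu$ be a Borel probability measure on a bounded metric space $X$. (1) For every dimension function $\Phi$, $$\dim_L\mu\le \underline{\dim}_\Phi\mu\le\overline{\dim}_\Phi\mu\le\dim_A\mu \quad\text{and}\quad \overline{\dim}_\Phi\mu\ge\overline{\dim}_\Phi(\mathrm{supp}\,\mu).$$ If $\mu$ is doubling, then $\underline{\dim}_\Phi\mu\le\underline{\dim}_\Phi(\mathrm{supp}\,\mu)$. (2) If $\Phi,\Psi$ are dimension functions with $\Phi(x)\le\Psi(x)$ for all $x$, then $\overline{\dim}_\Psi\mu\le\overline{\dim}_\Phi\mu$ and $\underline{\dim}_\Phi\mu\le\underline{\dim}_\Psi\mu$. (3) If $\Phi$ is a dimension function with $\Phi(x)\to0$ as $x\to0$, then $\underline{\dim}_\Phi\mu\le\dim_{qL}\mu$ and $\dim_{qA}\mu\le\overline{\dim}_\Phi\mu$. (4) If $\Phi$ is a dimension function and there exist a constant $C$ and $x_0>0$ such that $\Phi(x)\le C/|\log x|$ for $0<x\le x_0$, then $\overline{\dim}_\Phi\mu=\dim_A\mu$ and $\underline{\dim}_\Phi\mu=\dim_L\mu$.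
   Context: A dimension function is a map $\Phi:(0,1)\to[0,\infty)$ such that $x^{1+\Phi(x)}$ decreases to $0$ as $x$ decreases to $0$. $B(x,R)$ is the open ball of centre $x$ and radius $R$; $N_r(Y)$ is the least number of balls of radius $r$ that cover $Y$. For $E\subseteq X$, the upper $\Phi$-dimension $\overline{\dim}_\Phi E$ is the infimum of all $\alpha$ for which there exist $C_1,C_2>0$ such that for all $0<r\le R^{1+\Phi(R)}\le R<C_1$ and all $z\in E$, $N_r(B(z,R)\cap E)\le C_2(R/r)^\alpha$. The lower $\Phi$-dimension $\underline{\dim}_\Phi E$ is the supremum of all $\alpha$ for which there exist $C_1,C_2>0$ such that for the same $r,R,z$, $N_r(B(z,R)\cap E)\ge C_2(R/r)^\alpha$. For a measure $\mu$, $\overline{\dim}_\Phi\mu$ is the infimum of all $\alpha$ for which there exist $C_1,C_2>0$ such that for all $0<r<R^{1+\Phi(R)}\le R\le C_1$ and all $x\in\mathrm{supp}\,\mu$, $\mu(B(x,R))/\mu(B(x,r))\le C_2(R/r)^\alpha$; $\underline{\dim}_\Phi\mu$ is the supremum of all $\alpha$ for which there exist $C_1,C_2>0$ such that for the same $r,R,x$, $\mu(B(x,R))/\mu(B(x,r))\ge C_2(R/r)^\alpha$. Values in $[0,\infty]$ are allowed. The upper and lower Assouad dimensions $\dim_A\mu$, $\dim_L\mu$ are $\overline{\dim}_\Phi\mu$, $\underline{\dim}_\Phi\mu$ for $\Phi=0$. For $\theta\in(0,1)$ let $\Phi_\theta$ be the constant function $1/\theta-1$; the quasi-Assouad dimensions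 are $\dim_{qA}\mu=\lim_{\theta\to1}\overline{\dim}_{\Phi_\theta}\mu$ and $\dim_{qL}\mu=\lim_{\theta\to1}\underline{\dim}_{\Phi_\theta}\mu$. $\mu$ is doubling if there is a constant $C$ with $\mu(B(z,2R))\le C\mu(B(z,R))$ for all $R\le\mathrm{diam}\,X$ and $z\in\mathrm{supp}\,\mu$.
   Formalization: The measure μ is additionally assumed to be concentrated on its support, μ(supp μ)=1; this is automatic when X is separable, but may fail on exotic non-separable X (real-valued measurable cardinals), where supp μ may be empty and the first chain of inequalities breaks. *)

theory Defs
  imports "HOL-Probability.Probability"
begin

text \<open>
  The metric space \<open>X\<close> is the universe of a type of class \<^class>\<open>metric_space\<close>. Dimension functions
  are functions on \<open>real\<close> of which only the values on \<open>(0,1)\<close> are ever used; accordingly the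
  definitions below restrict the scale \<open>R\<close> to \<open>R < 1\<close>.
\<close>

definition dimension_function :: "(real \<Rightarrow> real) \<Rightarrow> bool" where
  "dimension_function \<Phi> \<longleftrightarrow>
     (\<forall>x\<in>{0<..<1}. 0 \<le> \<Phi> x) \<and>
     mono_on {0<..<1} (\<lambda>x. x powr (1 + \<Phi> x)) \<and>
     ((\<lambda>x. x powr (1 + \<Phi> x)) \<longlongrightarrow> 0) (at_right 0)"

text \<open>The value is \<open>\<infinity>\<close> if no finite cover exists. The centres need not lie in \<open>Y\<close>.\<close>

definition covering_number :: "real \<Rightarrow> 'a::metric_space set \<Rightarrow> enat" where
  "covering_number r Y = (INF F\<in>{F. finite F \<and> Y \<subseteq> (\<Union>c\<in>F. ball c r)}. enat (card F))"

text \<open>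
  The exponents \<open>\<alpha>\<close> range over \<open>[0,\<infinity>)\<close> and the dimensions are extended reals, so that they take
  values in \<open>[0,\<infinity>]\<close>, with \<open>Inf {} = \<infinity>\<close>.
\<close>

definition upper_Phi_dim_set :: "(real \<Rightarrow> real) \<Rightarrow> 'a::metric_space set \<Rightarrow> ereal" where
  "upper_Phi_dim_set \<Phi> E = Inf {ereal \<alpha> |\<alpha>. 0 \<le> \<alpha> \<and>
     (\<exists>C1>0. \<exists>C2>0. \<forall>r R. \<forall>z\<in>E.
        0 < r \<and> r \<le> R powr (1 + \<Phi> R) \<and> R powr (1 + \<Phi> R) \<le> R \<and> 0 < R \<and> R < C1 \<and> R < 1 \<longrightarrow>
        ereal_of_enat (covering_number r (ball z R \<inter> E)) \<le> ereal (C2 * (R / r) powr \<alpha>))}"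

definition lower_Phi_dim_set :: "(real \<Rightarrow> real) \<Rightarrow> 'a::metric_space set \<Rightarrow> ereal" where
  "lower_Phi_dim_set \<Phi> E = Sup {ereal \<alpha> |\<alpha>. 0 \<le> \<alpha> \<and>
     (\<exists>C1>0. \<exists>C2>0. \<forall>r R. \<forall>z\<in>E.
        0 < r \<and> r \<le> R powr (1 + \<Phi> R) \<and> R powr (1 + \<Phi> R) \<le> R \<and> 0 < R \<and> R < C1 \<and> R < 1 \<longrightarrow>
        ereal_of_enat (covering_number r (ball z R \<inter> E)) \<ge> ereal (C2 * (R / r) powr \<alpha>))}"

definition supp :: "'a::metric_space measure \<Rightarrow> 'a set" where
  "supp M = {x. \<forall>e>0. emeasure M (ball x e) > 0}"

definition upper_Phi_dim :: "(real \<Rightarrow> real) \<Rightarrow> 'a::metric_space measure \<Rightarrow> ereal" where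
  "upper_Phi_dim \<Phi> M = Inf {ereal \<alpha> |\<alpha>. 0 \<le> \<alpha> \<and>
     (\<exists>C1>0. \<exists>C2>0. \<forall>r R. \<forall>x\<in>supp M.
        0 < r \<and> r < R powr (1 + \<Phi> R) \<and> R powr (1 + \<Phi> R) \<le> R \<and> 0 < R \<and> R \<le> C1 \<and> R < 1 \<longrightarrow>
        measure M (ball x R) / measure M (ball x r) \<le> C2 * (R / r) powr \<alpha>)}"

definition lower_Phi_dim :: "(real \<Rightarrow> real) \<Rightarrow> 'a::metric_space measure \<Rightarrow> ereal" where
  "lower_Phi_dim \<Phi> M = Sup {ereal \<alpha> |\<alpha>. 0 \<le> \<alpha> \<and>
     (\<exists>C1>0. \<exists>C2>0. \<forall>r R. \<forall>x\<in>supp M.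
        0 < r \<and> r < R powr (1 + \<Phi> R) \<and> R powr (1 + \<Phi> R) \<le> R \<and> 0 < R \<and> R \<le> C1 \<and> R < 1 \<longrightarrow>
        measure M (ball x R) / measure M (ball x r) \<ge> C2 * (R / r) powr \<alpha>)}"

definition upper_Assouad_dim :: "'a::metric_space measure \<Rightarrow> ereal" where
  "upper_Assouad_dim M = upper_Phi_dim (\<lambda>_. 0) M"

definition lower_Assouad_dim :: "'a::metric_space measure \<Rightarrow> ereal" where
  "lower_Assouad_dim M = lower_Phi_dim (\<lambda>_. 0) M"

definition Phi_theta :: "real \<Rightarrow> real \<Rightarrow> real" where
  "Phi_theta \<theta> = (\<lambda>_. 1 / \<theta> - 1)"

definition upper_quasi_Assouad_dim :: "'a::metric_space measure \<Rightarrow> ereal" where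
  "upper_quasi_Assouad_dim M = Lim (at_left 1) (\<lambda>\<theta>. upper_Phi_dim (Phi_theta \<theta>) M)"

definition lower_quasi_Assouad_dim :: "'a::metric_space measure \<Rightarrow> ereal" where
  "lower_quasi_Assouad_dim M = Lim (at_left 1) (\<lambda>\<theta>. lower_Phi_dim (Phi_theta \<theta>) M)"

definition doubling_measure :: "'a::metric_space measure \<Rightarrow> bool" where
  "doubling_measure M \<longleftrightarrow>
     (\<exists>C. \<forall>z\<in>supp M. \<forall>R\<le>diameter (UNIV :: 'a set).
        measure M (ball z (2 * R)) \<le> C * measure M (ball z R))"

text \<open>
  The notion of support presupposes that the measure is concentrated on it. This is automatic on
  separable spaces (shown below), but cannot be derived for arbitrary metric spaces: on a discrete
  space of real-valued measurable cardinality there is a probability measure with empty support.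
\<close>

lemma measure_supp_eq_1:
  fixes M :: "'a::{metric_space, second_countable_topology} measure"
  assumes "prob_space M" "sets M = sets borel"
  shows "measure M (supp M) = 1"
proof -
  interpret prob_space M by fact
  have sp: "space M = UNIV" using sets_eq_imp_space_eq[OF assms(2)] by simp
  define B where "B = {ball x e |x e. e > 0 \<and> emeasure M (ball x e) = 0}"
  have op: "\<And>S. S \<in> B \<Longrightarrow> open S" by (auto simp: B_def)
  obtain B' where B': "B' \<subseteq> B" "countable B'" "\<Union>B' = \<Union>B"
    using Lindelof[of B] op by blast
  have "- supp M = \<Union>B"
  proof (intro set_eqI iffI)
    fix y assume "y \<in> - supp M"
    then show "y \<in> \<Union>B" by (force simp: B_def supp_def)
  next
    fix y assume "y \<in> \<Union>B"
    then obtain x e where xe: "y \<in> ball x e" "emeasure M (ball x e) = 0" by (auto simp: B_def)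
    then obtain d where d: "d > 0" "ball y d \<subseteq> ball x e"
      using openE[OF open_ball] by blast
    have "emeasure M (ball y d) \<le> emeasure M (ball x e)"
      by (rule emeasure_mono) (use d assms(2) in auto)
    with xe d show "y \<in> - supp M" by (auto simp: supp_def)
  qed
  moreover have "\<Union>B' \<in> null_sets M"
  proof -
    have "(\<Union>S\<in>B'. S) \<in> null_sets M"
      by (rule null_sets_UN') (use B' assms(2) in \<open>auto simp: B_def null_sets_def\<close>)
    then show ?thesis by simp
  qed
  ultimately have n: "- supp M \<in> null_sets M" using B'(3) by simp
  then have "measure M (UNIV - - supp M) = 1"
    using prob_compl[of "- supp M"] sp by (auto simp: null_sets_def measure_def)
  then show ?thesis by (simp add: Compl_eq_Diff_UNIV[symmetric])
qed

text \<open>The limits defining the quasi-Assouad dimensions exist, by monotonicity in \<open>\<theta>\<close>:\<close>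

lemma Phi_theta_scale_mono:
  assumes "0 < \<theta>" "\<theta> \<le> \<theta>'" "\<theta>' < 1" "0 < R" "R < 1"
  shows "R powr (1 + Phi_theta \<theta> R) \<le> R powr (1 + Phi_theta \<theta>' R)"
    and "R powr (1 + Phi_theta \<theta>' R) \<le> R"
proof -
  have "1 / \<theta>' \<le> 1 / \<theta>" using assms by (simp add: frac_le)
  then show "R powr (1 + Phi_theta \<theta> R) \<le> R powr (1 + Phi_theta \<theta>' R)"
    unfolding Phi_theta_def using assms by (intro powr_mono') auto
  have "1 \<le> 1 / \<theta>'" using assms by simp
  then have "R powr (1 / \<theta>') \<le> R powr 1" using assms by (intro powr_mono') auto
  then show "R powr (1 + Phi_theta \<theta>' R) \<le> R" using assms by (simp add: Phi_theta_def)
qed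

lemma upper_Phi_dim_theta_mono:
  assumes "0 < \<theta>" "\<theta> \<le> \<theta>'" "\<theta>' < 1"
  shows "upper_Phi_dim (Phi_theta \<theta>) M \<le> upper_Phi_dim (Phi_theta \<theta>') M"
  unfolding upper_Phi_dim_def
proof (rule Inf_superset_mono, safe, goal_cases)
  case (1 _ \<alpha> C1 C2)
  then show ?case
    using Phi_theta_scale_mono[OF assms]
    apply -
    apply (rule exI[of _ \<alpha>], rule conjI[OF refl], rule conjI, assumption)
    apply (rule exI[of _ C1], rule conjI, assumption)
    apply (rule exI[of _ C2], rule conjI, assumption)
    apply (auto intro: less_le_trans)
    done
qed

lemma lower_Phi_dim_theta_antimono:
  assumes "0 < \<theta>" "\<theta> \<le> \<theta>'" "\<theta>' < 1"
  shows "lower_Phi_dim (Phi_theta \<theta>') M \<le> lower_Phi_dim (Phi_theta \<theta>) M"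
  unfolding lower_Phi_dim_def
proof (rule Sup_subset_mono, safe, goal_cases)
  case (1 _ \<alpha> C1 C2)
  then show ?case
    using Phi_theta_scale_mono[OF assms]
    apply -
    apply (rule exI[of _ \<alpha>], rule conjI[OF refl], rule conjI, assumption)
    apply (rule exI[of _ C1], rule conjI, assumption)
    apply (rule exI[of _ C2], rule conjI, assumption)
    apply (auto intro: less_le_trans)
    done
qed

lemma upper_quasi_Assouad_dim_tendsto:
  "((\<lambda>\<theta>. upper_Phi_dim (Phi_theta \<theta>) M) \<longlongrightarrow> upper_quasi_Assouad_dim M) (at_left 1)"
proof -
  let ?f = "\<lambda>\<theta>. upper_Phi_dim (Phi_theta \<theta>) M"
  have *: "eventually (\<lambda>\<theta>. b < \<theta> \<and> 0 < \<theta> \<and> \<theta> < 1) (at_left 1)" if "b < 1" for b :: real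
    using that by (auto simp: eventually_at_left[of 0 "1::real"] intro!: exI[of _ "max b 0"])
  have "(?f \<longlongrightarrow> (SUP \<theta>\<in>{0<..<1}. ?f \<theta>)) (at_left 1)"
  proof (rule order_tendstoI)
    fix a assume "a < (SUP \<theta>\<in>{0<..<1}. ?f \<theta>)"
    then obtain t where t: "0 < t" "t < 1" "a < ?f t" by (auto simp: less_SUP_iff)
    show "eventually (\<lambda>\<theta>. a < ?f \<theta>) (at_left 1)"
      using *[OF t(2)]
    proof eventually_elim
      case (elim \<theta>)
      then have "?f t \<le> ?f \<theta>" using t by (intro upper_Phi_dim_theta_mono) auto
      with t show ?case by order
    qed
  next
    fix a assume a: "(SUP \<theta>\<in>{0<..<1}. ?f \<theta>) < a"
    show "eventually (\<lambda>\<theta>. ?f \<theta> < a) (at_left 1)"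
      using *[of 0, simplified]
    proof eventually_elim
      case (elim \<theta>)
      then have "?f \<theta> \<le> (SUP \<theta>\<in>{0<..<1}. ?f \<theta>)" by (intro SUP_upper) auto
      with a show ?case by order
    qed
  qed
  then show ?thesis
    unfolding upper_quasi_Assouad_dim_def by (simp add: tendsto_Lim)
qed

lemma lower_quasi_Assouad_dim_tendsto:
  "((\<lambda>\<theta>. lower_Phi_dim (Phi_theta \<theta>) M) \<longlongrightarrow> lower_quasi_Assouad_dim M) (at_left 1)"
proof -
  let ?f = "\<lambda>\<theta>. lower_Phi_dim (Phi_theta \<theta>) M"
  have *: "eventually (\<lambda>\<theta>. b < \<theta> \<and> 0 < \<theta> \<and> \<theta> < 1) (at_left 1)" if "b < 1" for b :: real
    using that by (auto simp: eventually_at_left[of 0 "1::real"] intro!: exI[of _ "max b 0"])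
  have "(?f \<longlongrightarrow> (INF \<theta>\<in>{0<..<1}. ?f \<theta>)) (at_left 1)"
  proof (rule order_tendstoI)
    fix a assume "(INF \<theta>\<in>{0<..<1}. ?f \<theta>) < a"
    then obtain t where t: "0 < t" "t < 1" "?f t < a" by (auto simp: INF_less_iff)
    show "eventually (\<lambda>\<theta>. ?f \<theta> < a) (at_left 1)"
      using *[OF t(2)]
    proof eventually_elim
      case (elim \<theta>)
      then have "?f \<theta> \<le> ?f t" using t by (intro lower_Phi_dim_theta_antimono) auto
      with t show ?case by order
    qed
  next
    fix a assume a: "a < (INF \<theta>\<in>{0<..<1}. ?f \<theta>)"
    show "eventually (\<lambda>\<theta>. a < ?f \<theta>) (at_left 1)"
      using *[of 0, simplified]
    proof eventually_elim
      case (elim \<theta>)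
      then have "(INF \<theta>\<in>{0<..<1}. ?f \<theta>) \<le> ?f \<theta>" by (intro INF_lower) auto
      with a show ?case by order
    qed
  qed
  then show ?thesis
    unfolding lower_quasi_Assouad_dim_def by (simp add: tendsto_Lim)
qed

end

theory Submission
  imports Defs
begin

text \<open>
  Write \<open>h R = R powr (1 + \<Phi> R)\<close>, the bound that \<open>\<Phi>\<close> puts on inner scales at the outer scale \<open>R\<close>.
  Everything rests on transporting an admissible exponent, together with its constants, from one
  dimension to another.

  A larger \<open>\<Phi>\<close> means a smaller \<open>h\<close>, hence fewer pairs \<open>(r, R)\<close> to be tested; since only small \<open>R\<close>
  matter, it suffices to compare two functions near \<open>0\<close>. This one observation gives the
  comparison with the Assouad dimensions, the monotonicity in \<open>\<Phi>\<close>, and, because every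
  \<open>\<Phi>\<close> tending to \<open>0\<close> is eventually below each constant \<open>1 / \<theta> - 1\<close>, the comparison with the
  quasi-Assouad dimensions. If \<open>\<Phi> x \<le> C / \<bar>ln x\<bar>\<close>, then \<open>h R \<ge> exp (- C) * R\<close>, so \<open>\<Phi>\<close> ignores
  only pairs of comparable scales, and those merely affect the constant. Lower dimensions lie below
  upper ones because both bounds hold along \<open>r \<rightarrow> 0\<close> at a single point of the support and a single
  outer scale.

  The two comparisons with the support are volume arguments. For the upper one, a maximal
  \<open>r\<close>-separated subset of a ball of radius \<open>R\<close> is a cover by \<open>r\<close>-balls, while the balls of radius
  \<open>r/2\<close> around its points are disjoint, lie in a ball of radius \<open>2R\<close>, and each carries a definite
  fraction of its mass. For the lower one, a cover by \<open>N\<close> balls of radius \<open>r\<close> must carry the whole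
  mass of the \<open>R\<close>-ball, while each of its balls carries only a small fraction of it; the doubling
  condition absorbs the enlargements needed to centre these balls at points of the support.
\<close>

section \<open>Covering numbers\<close>

text \<open>
  An \<open>r\<close>-separated set of largest size is an \<open>r\<close>-net: a point at distance at least \<open>r\<close> from all of
  it could be added.
\<close>

lemma covering_number_le_if_separated_card_le:
  fixes Y :: "'a::metric_space set"
  assumes "r > 0"
    and bound: "\<And>S. finite S \<Longrightarrow> S \<subseteq> Y \<Longrightarrow> (\<And>x y. x \<in> S \<Longrightarrow> y \<in> S \<Longrightarrow> x \<noteq> y \<Longrightarrow> r \<le> dist x y)
      \<Longrightarrow> real (card S) \<le> K"
  shows "ereal_of_enat (covering_number r Y) \<le> ereal K"
proof -
  define sep where "sep S \<longleftrightarrow> finite S \<and> S \<subseteq> Y \<and> (\<forall>x\<in>S. \<forall>y\<in>S. x \<noteq> y \<longrightarrow> r \<le> dist x y)" for S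
  have le: "real (card S) \<le> K" if "sep S" for S
    using that by (intro bound) (auto simp: sep_def)
  have "sep {}" by (simp add: sep_def)
  moreover have "\<forall>S. sep S \<longrightarrow> card S < Suc (nat \<lfloor>K\<rfloor>)"
    using le by (simp add: le_nat_floor less_Suc_eq_le)
  ultimately have "\<exists>S. sep S \<and> (\<forall>T. sep T \<longrightarrow> card T \<le> card S)"
    by (rule ex_has_greatest_nat)
  then obtain S where S: "sep S" and max: "\<And>T. sep T \<Longrightarrow> card T \<le> card S" by blast
  have "Y \<subseteq> (\<Union>c\<in>S. ball c r)"
  proof (rule ccontr)
    assume "\<not> ?thesis"
    then obtain y where y: "y \<in> Y" "\<And>c. c \<in> S \<Longrightarrow> r \<le> dist c y" by (force simp: not_less)
    then have "y \<notin> S" using \<open>r > 0\<close> by force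
    moreover have "sep (insert y S)"
      using S y by (auto simp: sep_def dist_commute)
    ultimately show False
      using max[of "insert y S"] S by (auto simp: sep_def)
  qed
  then have "covering_number r Y \<le> enat (card S)"
    unfolding covering_number_def using S by (intro INF_lower) (auto simp: sep_def)
  then have "ereal_of_enat (covering_number r Y) \<le> ereal_of_enat (enat (card S))"
    by (simp only: ereal_of_enat_le_iff)
  also have "\<dots> \<le> ereal K" using le[OF S] by simp
  finally show ?thesis .
qed

lemma le_covering_number_if_le_card:
  fixes Y :: "'a::metric_space set"
  assumes "\<And>F. finite F \<Longrightarrow> Y \<subseteq> (\<Union>c\<in>F. ball c r) \<Longrightarrow> K \<le> real (card F)"
  shows "ereal K \<le> ereal_of_enat (covering_number r Y)"
proof (cases "covering_number r Y")
  case (enat n)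
  then have "covering_number r Y < enat (Suc n)" by simp
  then obtain F where F: "finite F" "Y \<subseteq> (\<Union>c\<in>F. ball c r)" "card F < Suc n"
    unfolding covering_number_def INF_less_iff by auto
  then show ?thesis using assms[OF F(1,2)] enat by simp
qed simp

section \<open>Admissible exponents\<close>

definition upper_ratio_bound ::
    "(real \<Rightarrow> real) \<Rightarrow> 'a::metric_space measure \<Rightarrow> real \<Rightarrow> real \<Rightarrow> real \<Rightarrow> bool" where
  "upper_ratio_bound \<Phi> M \<alpha> C1 C2 \<longleftrightarrow> (\<forall>r R. \<forall>x\<in>supp M.
     0 < r \<and> r < R powr (1 + \<Phi> R) \<and> R powr (1 + \<Phi> R) \<le> R \<and> 0 < R \<and> R \<le> C1 \<and> R < 1 \<longrightarrow>
     measure M (ball x R) / measure M (ball x r) \<le> C2 * (R / r) powr \<alpha>)"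

definition lower_ratio_bound ::
    "(real \<Rightarrow> real) \<Rightarrow> 'a::metric_space measure \<Rightarrow> real \<Rightarrow> real \<Rightarrow> real \<Rightarrow> bool" where
  "lower_ratio_bound \<Phi> M \<alpha> C1 C2 \<longleftrightarrow> (\<forall>r R. \<forall>x\<in>supp M.
     0 < r \<and> r < R powr (1 + \<Phi> R) \<and> R powr (1 + \<Phi> R) \<le> R \<and> 0 < R \<and> R \<le> C1 \<and> R < 1 \<longrightarrow>
     measure M (ball x R) / measure M (ball x r) \<ge> C2 * (R / r) powr \<alpha>)"

lemma upper_ratio_boundD:
  assumes "upper_ratio_bound \<Phi> M \<alpha> C1 C2" "x \<in> supp M" "0 < r" "r < R powr (1 + \<Phi> R)"
    "R powr (1 + \<Phi> R) \<le> R" "0 < R" "R \<le> C1" "R < 1"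
  shows "measure M (ball x R) / measure M (ball x r) \<le> C2 * (R / r) powr \<alpha>"
  using assms by (simp add: upper_ratio_bound_def)

lemma lower_ratio_boundD:
  assumes "lower_ratio_bound \<Phi> M \<alpha> C1 C2" "x \<in> supp M" "0 < r" "r < R powr (1 + \<Phi> R)"
    "R powr (1 + \<Phi> R) \<le> R" "0 < R" "R \<le> C1" "R < 1"
  shows "C2 * (R / r) powr \<alpha> \<le> measure M (ball x R) / measure M (ball x r)"
  using assms by (simp add: lower_ratio_bound_def)

lemma upper_Phi_dim_eq:
  "upper_Phi_dim \<Phi> M =
    Inf (ereal ` {\<alpha>. 0 \<le> \<alpha> \<and> (\<exists>C1>0. \<exists>C2>0. upper_ratio_bound \<Phi> M \<alpha> C1 C2)})"
  unfolding upper_Phi_dim_def upper_ratio_bound_def setcompr_eq_image ..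

lemma lower_Phi_dim_eq:
  "lower_Phi_dim \<Phi> M =
    Sup (ereal ` {\<alpha>. 0 \<le> \<alpha> \<and> (\<exists>C1>0. \<exists>C2>0. lower_ratio_bound \<Phi> M \<alpha> C1 C2)})"
  unfolding lower_Phi_dim_def lower_ratio_bound_def setcompr_eq_image ..

lemma upper_Phi_dim_le_if_exponents:
  assumes "\<And>\<alpha> C1 C2. 0 \<le> \<alpha> \<Longrightarrow> C1 > 0 \<Longrightarrow> C2 > 0 \<Longrightarrow> upper_ratio_bound \<Phi> M \<alpha> C1 C2 \<Longrightarrow>
    \<exists>C1'>0. \<exists>C2'>0. upper_ratio_bound \<Psi> M \<alpha> C1' C2'"
  shows "upper_Phi_dim \<Psi> M \<le> upper_Phi_dim \<Phi> M"
  unfolding upper_Phi_dim_eq using assms by (intro Inf_superset_mono image_mono Collect_mono) metis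

lemma lower_Phi_dim_le_if_exponents:
  assumes "\<And>\<alpha> C1 C2. 0 \<le> \<alpha> \<Longrightarrow> C1 > 0 \<Longrightarrow> C2 > 0 \<Longrightarrow> lower_ratio_bound \<Phi> M \<alpha> C1 C2 \<Longrightarrow>
    \<exists>C1'>0. \<exists>C2'>0. lower_ratio_bound \<Psi> M \<alpha> C1' C2'"
  shows "lower_Phi_dim \<Phi> M \<le> lower_Phi_dim \<Psi> M"
  unfolding lower_Phi_dim_eq using assms by (intro Sup_subset_mono image_mono Collect_mono) metis

lemma powr_one_plus_le_self:
  fixes R :: real
  assumes "0 < R" "R < 1" "0 \<le> p"
  shows "R powr (1 + p) \<le> R"
  using powr_mono'[of 1 "1 + p" R] assms by simp

text \<open>
  Only the behaviour at small outer scales counts, so a comparison of \<open>\<Phi>\<close> and \<open>\<Psi>\<close> on some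
  \<open>(0, \<delta>)\<close> is enough; the scales beyond \<open>\<delta>\<close> are removed by shrinking \<open>C1\<close>.
\<close>

lemma Phi_dim_mono_near_0:
  assumes "\<delta> > 0" and le: "\<And>x. 0 < x \<Longrightarrow> x < \<delta> \<Longrightarrow> x < 1 \<Longrightarrow> 0 \<le> \<Phi> x \<and> \<Phi> x \<le> \<Psi> x"
  shows "upper_Phi_dim \<Psi> M \<le> upper_Phi_dim \<Phi> M"
    and "lower_Phi_dim \<Phi> M \<le> lower_Phi_dim \<Psi> M"
proof -
  have scale: "R powr (1 + \<Psi> R) \<le> R powr (1 + \<Phi> R) \<and> R powr (1 + \<Phi> R) \<le> R"
    if "0 < R" "R \<le> min C1 (\<delta> / 2)" "R < 1" for R C1
    using le[of R] that \<open>\<delta> > 0\<close> by (auto intro!: powr_mono' powr_one_plus_le_self)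
  have C1: "min C1 (\<delta> / 2) > 0" if "C1 > 0" for C1
    using that \<open>\<delta> > 0\<close> by simp
  have "upper_ratio_bound \<Psi> M \<alpha> (min C1 (\<delta> / 2)) C2" if "upper_ratio_bound \<Phi> M \<alpha> C1 C2" for \<alpha> C1 C2
    unfolding upper_ratio_bound_def
  proof (intro allI ballI impI, elim conjE)
    fix r R x
    assume "x \<in> supp M" "0 < r" "r < R powr (1 + \<Psi> R)" "0 < R" "R \<le> min C1 (\<delta> / 2)" "R < 1"
    then show "measure M (ball x R) / measure M (ball x r) \<le> C2 * (R / r) powr \<alpha>"
      using that scale[of R C1] by (simp add: upper_ratio_bound_def)
  qed
  then show "upper_Phi_dim \<Psi> M \<le> upper_Phi_dim \<Phi> M"
    using C1 by (intro upper_Phi_dim_le_if_exponents) blast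
  have "lower_ratio_bound \<Psi> M \<alpha> (min C1 (\<delta> / 2)) C2" if "lower_ratio_bound \<Phi> M \<alpha> C1 C2" for \<alpha> C1 C2
    unfolding lower_ratio_bound_def
  proof (intro allI ballI impI, elim conjE)
    fix r R x
    assume "x \<in> supp M" "0 < r" "r < R powr (1 + \<Psi> R)" "0 < R" "R \<le> min C1 (\<delta> / 2)" "R < 1"
    then show "C2 * (R / r) powr \<alpha> \<le> measure M (ball x R) / measure M (ball x r)"
      using that scale[of R C1] by (simp add: lower_ratio_bound_def)
  qed
  then show "lower_Phi_dim \<Phi> M \<le> lower_Phi_dim \<Psi> M"
    using C1 by (intro lower_Phi_dim_le_if_exponents) blast
qed

section \<open>Functions tending to zero and the quasi-Assouad dimensions\<close>

lemma quasi_Assouad_dim_bounds: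
  assumes nonneg: "\<And>x. 0 < x \<Longrightarrow> x < 1 \<Longrightarrow> 0 \<le> \<Phi> x"
    and lim: "(\<Phi> \<longlongrightarrow> 0) (at_right 0)"
  shows "lower_Phi_dim \<Phi> M \<le> lower_quasi_Assouad_dim M"
    and "upper_quasi_Assouad_dim M \<le> upper_Phi_dim \<Phi> M"
proof -
  have bounds: "lower_Phi_dim \<Phi> M \<le> lower_Phi_dim (Phi_theta \<theta>) M \<and>
      upper_Phi_dim (Phi_theta \<theta>) M \<le> upper_Phi_dim \<Phi> M" if "0 < \<theta>" "\<theta> < 1" for \<theta>
  proof -
    have "0 < 1 / \<theta> - 1" using that by simp
    from order_tendstoD(2)[OF lim this]
    obtain \<delta> where \<delta>: "\<delta> > 0" "\<And>x. 0 < x \<Longrightarrow> x < \<delta> \<Longrightarrow> \<Phi> x < 1 / \<theta> - 1"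
      by (auto simp: eventually_at_right_field)
    have "0 \<le> \<Phi> x \<and> \<Phi> x \<le> Phi_theta \<theta> x" if "0 < x" "x < \<delta>" "x < 1" for x
      using \<delta>(2)[of x] nonneg[of x] that by (simp add: Phi_theta_def)
    then show ?thesis
      using Phi_dim_mono_near_0[OF \<delta>(1), of \<Phi> "Phi_theta \<theta>"] by blast
  qed
  have ev: "eventually (\<lambda>\<theta>::real. 0 < \<theta> \<and> \<theta> < 1) (at_left 1)"
    by (auto simp: eventually_at_left_field intro!: exI[of _ 0])
  show "lower_Phi_dim \<Phi> M \<le> lower_quasi_Assouad_dim M"
    by (rule tendsto_lowerbound[OF lower_quasi_Assouad_dim_tendsto eventually_mono[OF ev]])
      (use bounds in auto)
  show "upper_quasi_Assouad_dim M \<le> upper_Phi_dim \<Phi> M"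
    by (rule tendsto_upperbound[OF upper_quasi_Assouad_dim_tendsto eventually_mono[OF ev]])
      (use bounds in auto)
qed

section \<open>Masses of balls\<close>

locale borel_prob_space = prob_space M for M :: "'a::metric_space measure" +
  assumes sets_eq_borel: "sets M = sets borel"
begin

lemma open_sets: "open A \<Longrightarrow> A \<in> sets M"
  by (simp add: sets_eq_borel)

lemma prob_mono_ball: "ball x r \<subseteq> ball y s \<Longrightarrow> prob (ball x r) \<le> prob (ball y s)"
  by (intro finite_measure_mono open_sets) auto

lemma prob_ball_pos: "x \<in> supp M \<Longrightarrow> r > 0 \<Longrightarrow> 0 < prob (ball x r)"
  by (auto simp: supp_def emeasure_eq_measure)

lemma closed_supp: "closed (supp M)"
proof -
  have "open (- supp M)"
    unfolding open_contains_ball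
  proof
    fix y assume "y \<in> - supp M"
    then obtain e where e: "e > 0" "emeasure M (ball y e) = 0" by (auto simp: supp_def)
    have "ball y (e/2) \<subseteq> - supp M"
    proof
      fix w assume "w \<in> ball y (e/2)"
      then have "ball w (e/2) \<subseteq> ball y e" by metric
      then have "emeasure M (ball w (e/2)) \<le> emeasure M (ball y e)"
        by (intro emeasure_mono open_sets) auto
      with e show "w \<in> - supp M" by (auto simp: supp_def intro!: exI[of _ "e/2"])
    qed
    then show "\<exists>e>0. ball y e \<subseteq> - supp M" using e by (intro exI[of _ "e/2"]) auto
  qed
  then show ?thesis by (simp add: closed_def)
qed

lemma prob_ratio_ge_1:
  assumes "x \<in> supp M" "0 < r" "r \<le> R"
  shows "1 \<le> prob (ball x R) / prob (ball x r)"
  using prob_ball_pos[OF assms(1,2)] prob_mono_ball[of x r x R] assms by (simp add: subset_ball)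

section \<open>Lower against upper dimension\<close>

text \<open>
  At one point of the support and one outer scale \<open>R\<close>, two admissible exponents \<open>\<alpha>\<close> and \<open>\<beta>\<close> give
  \<open>C2 * t powr \<alpha> \<le> D2 * t powr \<beta>\<close> for all large \<open>t = R / r\<close>, which is impossible for \<open>\<alpha> > \<beta>\<close>.
\<close>

lemma lower_exponent_le_upper_exponent:
  assumes nonneg: "\<And>x. 0 < x \<Longrightarrow> x < 1 \<Longrightarrow> 0 \<le> \<Phi> x"
    and x: "x \<in> supp M"
    and low: "lower_ratio_bound \<Phi> M \<alpha> C1 C2" and pos: "C1 > 0" "C2 > 0"
    and up: "upper_ratio_bound \<Phi> M \<beta> D1 D2" and D1: "D1 > 0"
  shows "\<alpha> \<le> \<beta>"
proof (rule ccontr)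
  assume "\<not> \<alpha> \<le> \<beta>"
  define R where "R = min (1/2) (min C1 D1)"
  have R: "0 < R" "R < 1" "R \<le> C1" "R \<le> D1" using pos D1 by (auto simp: R_def)
  define h where "h = R powr (1 + \<Phi> R)"
  have h: "0 < h" "h \<le> R" using R nonneg[of R] by (auto simp: h_def intro: powr_one_plus_le_self)
  have bound: "C2 * t powr (\<alpha> - \<beta>) \<le> D2" if t: "t > R / h" for t
  proof -
    have "t > 0" using t R h by (meson divide_pos_pos order_less_trans)
    moreover have "R / t < h" using t h \<open>t > 0\<close> by (simp add: field_simps)
    moreover have "0 < R / t" using R \<open>t > 0\<close> by simp
    ultimately have scales: "0 < R / t" "R / t < R powr (1 + \<Phi> R)" "R powr (1 + \<Phi> R) \<le> R"
      using h by (simp_all only: h_def)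
    have "C2 * (R / (R / t)) powr \<alpha> \<le> prob (ball x R) / prob (ball x (R / t))"
      by (rule lower_ratio_boundD[OF low x scales]) (use R in auto)
    also have "\<dots> \<le> D2 * (R / (R / t)) powr \<beta>"
      by (rule upper_ratio_boundD[OF up x scales]) (use R in auto)
    finally have "C2 * t powr \<alpha> \<le> D2 * t powr \<beta>" using R by simp
    then show ?thesis using \<open>t > 0\<close> by (simp add: powr_diff field_simps)
  qed
  have "filterlim (\<lambda>t. C2 * t powr (\<alpha> - \<beta>)) at_top at_top"
    using \<open>\<not> \<alpha> \<le> \<beta>\<close> pos by real_asymp
  then have "eventually (\<lambda>t. D2 < C2 * t powr (\<alpha> - \<beta>)) at_top"
    by (simp add: filterlim_at_top_dense)
  then have "eventually (\<lambda>t::real. False) at_top"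
    using eventually_gt_at_top[of "R / h"]
    by eventually_elim (use bound in \<open>force simp: not_le\<close>)
  then show False by simp
qed

lemma lower_Phi_dim_le_upper_Phi_dim:
  assumes "\<And>x. 0 < x \<Longrightarrow> x < 1 \<Longrightarrow> 0 \<le> \<Phi> x" and "supp M \<noteq> {}"
  shows "lower_Phi_dim \<Phi> M \<le> upper_Phi_dim \<Phi> M"
proof -
  from assms(2) obtain x where "x \<in> supp M" by blast
  then show ?thesis
    unfolding lower_Phi_dim_eq upper_Phi_dim_eq
    by (intro Sup_least Inf_greatest)
      (clarsimp, rule lower_exponent_le_upper_exponent[where \<Phi> = \<Phi>, OF assms(1)])
qed

section \<open>Functions of logarithmic decay\<close>

lemma powr_one_plus_ge_if_le_inverse_ln:
  fixes R :: real
  assumes "0 < R" "R < 1" "p \<le> C / \<bar>ln R\<bar>"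
  shows "exp (- C) * R \<le> R powr (1 + p)"
proof -
  have "p * - ln R \<le> C" using assms by (simp add: field_simps)
  then have "exp (- C) \<le> R powr p" using assms by (simp add: powr_def)
  then show ?thesis using assms by (simp add: powr_add)
qed

text \<open>
  Replacing \<open>r\<close> by the comparable radius \<open>c * r / 2\<close> makes every pair \<open>r < R\<close> admissible for \<open>\<Phi>\<close>;
  the smaller ball has smaller mass, so an upper bound survives with a larger constant.
\<close>

lemma upper_Assouad_dim_le_upper_Phi_dim:
  assumes c: "0 < c" "c \<le> 1" and "x0 > 0"
    and nonneg: "\<And>x. 0 < x \<Longrightarrow> x < 1 \<Longrightarrow> 0 \<le> \<Phi> x"
    and scale: "\<And>R. 0 < R \<Longrightarrow> R \<le> x0 \<Longrightarrow> R < 1 \<Longrightarrow> c * R \<le> R powr (1 + \<Phi> R)"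
  shows "upper_Assouad_dim M \<le> upper_Phi_dim \<Phi> M"
  unfolding upper_Assouad_dim_def
proof (rule upper_Phi_dim_le_if_exponents)
  fix \<alpha> C1 C2 :: real
  assume \<alpha>: "0 \<le> \<alpha>" and C: "C1 > 0" "C2 > 0" and up: "upper_ratio_bound \<Phi> M \<alpha> C1 C2"
  have "upper_ratio_bound (\<lambda>_. 0) M \<alpha> (min C1 x0) (C2 * (2 / c) powr \<alpha>)"
    unfolding upper_ratio_bound_def
  proof (intro allI ballI impI, elim conjE)
    fix r R x
    assume x: "x \<in> supp M" and R: "0 < R" "R \<le> min C1 x0" "R < 1"
      and r: "0 < r" "r < R powr (1 + 0)"
    define s where "s = c * r / 2"
    have s: "0 < s" "s < c * R" "s \<le> r" using c r R by (auto simp: s_def)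
    have "c * R \<le> R powr (1 + \<Phi> R)" using scale R by simp
    with s have "s < R powr (1 + \<Phi> R)" by linarith
    then have "prob (ball x R) / prob (ball x s) \<le> C2 * (R / s) powr \<alpha>"
      using R s nonneg by (intro upper_ratio_boundD[OF up x]) (auto intro: powr_one_plus_le_self)
    moreover have "prob (ball x R) / prob (ball x r) \<le> prob (ball x R) / prob (ball x s)"
      using prob_ball_pos[OF x s(1)] s(3)
      by (intro divide_left_mono prob_mono_ball subset_ball mult_pos_pos)
        (auto intro: prob_ball_pos[OF x r(1)])
    moreover have "(R / s) powr \<alpha> = (2 / c) powr \<alpha> * (R / r) powr \<alpha>"
      using c r R by (simp add: s_def powr_mult[symmetric] mult.commute)
    ultimately show "prob (ball x R) / prob (ball x r) \<le> C2 * (2 / c) powr \<alpha> * (R / r) powr \<alpha>"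
      by (simp add: mult.assoc)
  qed
  then show "\<exists>C1'>0. \<exists>C2'>0. upper_ratio_bound (\<lambda>_. 0) M \<alpha> C1' C2'"
    using C c \<open>x0 > 0\<close>
    by (intro exI[of _ "min C1 x0"] exI[of _ "C2 * (2 / c) powr \<alpha>"] conjI) auto
qed

text \<open>
  On the pairs that \<open>\<Phi>\<close> ignores, \<open>R / r\<close> is at most \<open>1 / c\<close>, so the trivial lower bound \<open>1\<close> for the
  ratio of masses is already of the required form.
\<close>

lemma lower_Phi_dim_le_lower_Assouad_dim:
  assumes c: "0 < c" and "x0 > 0"
    and nonneg: "\<And>x. 0 < x \<Longrightarrow> x < 1 \<Longrightarrow> 0 \<le> \<Phi> x"
    and scale: "\<And>R. 0 < R \<Longrightarrow> R \<le> x0 \<Longrightarrow> R < 1 \<Longrightarrow> c * R \<le> R powr (1 + \<Phi> R)"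
  shows "lower_Phi_dim \<Phi> M \<le> lower_Assouad_dim M"
  unfolding lower_Assouad_dim_def
proof (rule lower_Phi_dim_le_if_exponents)
  fix \<alpha> C1 C2 :: real
  assume \<alpha>: "0 \<le> \<alpha>" and C: "C1 > 0" "C2 > 0" and low: "lower_ratio_bound \<Phi> M \<alpha> C1 C2"
  have "lower_ratio_bound (\<lambda>_. 0) M \<alpha> (min C1 x0) (min C2 (c powr \<alpha>))"
    unfolding lower_ratio_bound_def
  proof (intro allI ballI impI, elim conjE)
    fix r R x
    assume x: "x \<in> supp M" and R: "0 < R" "R \<le> min C1 x0" "R < 1"
      and r: "0 < r" "r < R powr (1 + 0)"
    show "min C2 (c powr \<alpha>) * (R / r) powr \<alpha> \<le> prob (ball x R) / prob (ball x r)"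
    proof (cases "r < R powr (1 + \<Phi> R)")
      case True
      then have "C2 * (R / r) powr \<alpha> \<le> prob (ball x R) / prob (ball x r)"
        using R r nonneg by (intro lower_ratio_boundD[OF low x]) (auto intro: powr_one_plus_le_self)
      moreover have "min C2 (c powr \<alpha>) * (R / r) powr \<alpha> \<le> C2 * (R / r) powr \<alpha>"
        by (intro mult_right_mono) auto
      ultimately show ?thesis by linarith
    next
      case False
      then have "c * R \<le> r" using scale[of R] R by simp
      then have "c * (R / r) \<le> 1" using r by simp
      then have "(c * (R / r)) powr \<alpha> \<le> 1"
        using \<alpha> c R r by (intro powr_le1) auto
      then have "c powr \<alpha> * (R / r) powr \<alpha> \<le> 1"
        using c R r by (simp only: powr_mult)
      moreover have "min C2 (c powr \<alpha>) * (R / r) powr \<alpha> \<le> c powr \<alpha> * (R / r) powr \<alpha>"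
        by (intro mult_right_mono) auto
      moreover have "1 \<le> prob (ball x R) / prob (ball x r)"
        using x r R by (intro prob_ratio_ge_1) auto
      ultimately show ?thesis by linarith
    qed
  qed
  then show "\<exists>C1'>0. \<exists>C2'>0. lower_ratio_bound (\<lambda>_. 0) M \<alpha> C1' C2'"
    using C c \<open>x0 > 0\<close>
    by (intro exI[of _ "min C1 x0"] exI[of _ "min C2 (c powr \<alpha>)"] conjI) auto
qed

section \<open>Upper dimension of the support\<close>

text \<open>
  The balls of radius \<open>r / 2\<close> around the points of \<open>S\<close> are disjoint subsets of \<open>ball z (2 * R)\<close>, which
  in turn is contained in the ball of radius \<open>3 * R\<close> around each of these points.
\<close>

lemma separated_card_le:
  assumes "finite S" "S \<subseteq> ball z R" and sep: "\<And>x y. x \<in> S \<Longrightarrow> y \<in> S \<Longrightarrow> x \<noteq> y \<Longrightarrow> r \<le> dist x y"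
    and r: "0 < r" "r \<le> R" and z: "z \<in> supp M" and "K > 0"
    and ratio: "\<And>x. x \<in> S \<Longrightarrow> prob (ball x (3 * R)) \<le> K * prob (ball x (r / 2))"
  shows "real (card S) \<le> K"
proof -
  let ?m = "prob (ball z (2 * R))"
  have m: "?m > 0" using r by (intro prob_ball_pos z) auto
  have "disjoint_family_on (\<lambda>x. ball x (r / 2)) S"
    unfolding disjoint_family_on_def
  proof (intro ballI impI)
    fix x y assume "x \<in> S" "y \<in> S" "x \<noteq> y"
    then have "r \<le> dist x y" by (rule sep)
    then show "ball x (r / 2) \<inter> ball y (r / 2) = {}" by (intro disjoint_ballI) simp
  qed
  then have "(\<Sum>x\<in>S. prob (ball x (r / 2))) = prob (\<Union>x\<in>S. ball x (r / 2))"
    using \<open>finite S\<close> by (intro finite_measure_finite_Union[symmetric]) (auto intro!: open_sets)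
  also have "\<dots> \<le> ?m"
  proof (intro finite_measure_mono open_sets open_ball UN_least)
    fix x assume "x \<in> S"
    then have "x \<in> ball z R" using assms by blast
    then show "ball x (r / 2) \<subseteq> ball z (2 * R)" using r by metric
  qed
  finally have sum: "(\<Sum>x\<in>S. prob (ball x (r / 2))) \<le> ?m" .
  have "real (card S) * ?m = (\<Sum>x\<in>S. ?m)" by simp
  also have "\<dots> \<le> (\<Sum>x\<in>S. K * prob (ball x (r / 2)))"
  proof (rule sum_mono)
    fix x assume x: "x \<in> S"
    then have "x \<in> ball z R" using assms by blast
    then have "ball z (2 * R) \<subseteq> ball x (3 * R)" by metric
    then show "?m \<le> K * prob (ball x (r / 2))"
      using prob_mono_ball ratio[OF x] by (meson order_trans)
  qed
  also have "\<dots> \<le> K * ?m"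
    using sum \<open>K > 0\<close> by (simp add: sum_distrib_left[symmetric])
  finally show ?thesis using m by simp
qed

lemma upper_Phi_dim_set_supp_le:
  assumes "dimension_function \<Phi>"
  shows "upper_Phi_dim_set \<Phi> (supp M) \<le> upper_Phi_dim \<Phi> M"
  unfolding upper_Phi_dim_set_def upper_Phi_dim_eq setcompr_eq_image
proof (rule Inf_superset_mono, rule image_mono, rule Collect_mono, safe)
  fix \<alpha> C1 C2 :: real
  assume \<alpha>: "0 \<le> \<alpha>" and C: "C1 > 0" "C2 > 0" and up: "upper_ratio_bound \<Phi> M \<alpha> C1 C2"
  have nonneg: "\<And>x. 0 < x \<Longrightarrow> x < 1 \<Longrightarrow> 0 \<le> \<Phi> x"
    and mono: "mono_on {0<..<1} (\<lambda>x. x powr (1 + \<Phi> x))"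
    using assms by (auto simp: dimension_function_def)
  \<comment> \<open>Keeping \<open>R\<close> below both thresholds divided by \<open>3\<close> makes the outer radius \<open>3 * R\<close> admissible; the
    factor \<open>6\<close> is the quotient of the radii \<open>3 * R\<close> and \<open>r / 2\<close> relative to \<open>R / r\<close>.\<close>
  define C1' C2' where "C1' = min (C1 / 3) (1 / 3)" and "C2' = C2 * 6 powr \<alpha>"
  have "ereal_of_enat (covering_number r (ball z R \<inter> supp M)) \<le> ereal (C2' * (R / r) powr \<alpha>)"
    if z: "z \<in> supp M" and r: "0 < r" "r \<le> R powr (1 + \<Phi> R)" and "R powr (1 + \<Phi> R) \<le> R"
      and R: "0 < R" "R < C1'" for r R z
  proof (rule covering_number_le_if_separated_card_le[OF r(1)])
    fix S :: "'a set"
    assume S: "finite S" "S \<subseteq> ball z R \<inter> supp M"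
      "\<And>x y. x \<in> S \<Longrightarrow> y \<in> S \<Longrightarrow> x \<noteq> y \<Longrightarrow> r \<le> dist x y"
    have R3: "3 * R < 1" "3 * R \<le> C1" using R by (auto simp: C1'_def)
    have "R powr (1 + \<Phi> R) \<le> (3 * R) powr (1 + \<Phi> (3 * R))"
      using mono_onD[OF mono, of R "3 * R"] R R3 by simp
    then have h: "r / 2 < (3 * R) powr (1 + \<Phi> (3 * R))"
      "(3 * R) powr (1 + \<Phi> (3 * R)) \<le> 3 * R"
      using r R R3 nonneg[of "3 * R"] powr_one_plus_le_self[of "3 * R" "\<Phi> (3 * R)"] by auto
    show "real (card S) \<le> C2' * (R / r) powr \<alpha>"
    proof (rule separated_card_le[OF S(1) _ S(3) r(1) _ z])
      show "prob (ball x (3 * R)) \<le> C2' * (R / r) powr \<alpha> * prob (ball x (r / 2))" if "x \<in> S" for x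
      proof -
        have x: "x \<in> supp M" using that S by blast
        have "prob (ball x (3 * R)) / prob (ball x (r / 2)) \<le> C2 * (3 * R / (r / 2)) powr \<alpha>"
          using r R R3 by (intro upper_ratio_boundD[OF up x _ h]) auto
        also have "\<dots> = C2' * (R / r) powr \<alpha>"
          using r R by (simp add: C2'_def powr_mult[symmetric])
        finally show ?thesis using prob_ball_pos[OF x, of "r / 2"] r by (simp add: divide_le_eq)
      qed
    qed (use S r R C that in \<open>auto simp: C2'_def\<close>)
  qed
  moreover have "C1' > 0" "C2' > 0" using C by (auto simp: C1'_def C2'_def)
  ultimately show "\<exists>C1>0. \<exists>C2>0. \<forall>r R. \<forall>z\<in>supp M.
      0 < r \<and> r \<le> R powr (1 + \<Phi> R) \<and> R powr (1 + \<Phi> R) \<le> R \<and> 0 < R \<and> R < C1 \<and> R < 1 \<longrightarrow>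
      ereal_of_enat (covering_number r (ball z R \<inter> supp M)) \<le> ereal (C2 * (R / r) powr \<alpha>)"
    by (intro exI[of _ C1'] exI[of _ C2'] conjI) auto
qed

section \<open>Lower dimension of the support of a doubling measure\<close>

text \<open>
  Beyond the diameter all balls are the whole space, so the restriction on the radius disappears.
\<close>

lemma doubling_all_radii:
  assumes "bounded (UNIV :: 'a set)" "doubling_measure M"
  obtains D where "D \<ge> 1" "\<And>z R. z \<in> supp M \<Longrightarrow> prob (ball z (2 * R)) \<le> D * prob (ball z R)"
proof -
  obtain C where C: "\<And>z R. z \<in> supp M \<Longrightarrow> R \<le> diameter (UNIV :: 'a set) \<Longrightarrow>
      prob (ball z (2 * R)) \<le> C * prob (ball z R)"
    using assms(2) by (auto simp: doubling_measure_def)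
  show ?thesis
  proof (rule that[of "max 1 C"])
    fix z R assume z: "z \<in> supp M"
    show "prob (ball z (2 * R)) \<le> max 1 C * prob (ball z R)"
    proof (cases "R \<le> diameter (UNIV :: 'a set)")
      case True
      have "C * prob (ball z R) \<le> max 1 C * prob (ball z R)" by (intro mult_right_mono) auto
      with C[OF z True] show ?thesis by linarith
    next
      case False
      have "y \<in> ball z R" for y
        using False diameter_bounded_bound[OF assms(1), of z y] by simp
      then have "ball z (2 * R) \<subseteq> ball z R" by blast
      then have "prob (ball z (2 * R)) \<le> prob (ball z R)" by (rule prob_mono_ball)
      also have "\<dots> \<le> max 1 C * prob (ball z R)" by (intro mult_le_cancel_right1[THEN iffD2]) auto
      finally show ?thesis .
    qed
  qed simp
qed

text \<open>
  The centres of a cover are arbitrary points of the space, but a ball \<open>ball c r\<close> that meets the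
  support at \<open>y\<close> is contained in \<open>ball y (2 * r)\<close>, and only such balls carry mass.
\<close>

lemma prob_le_card_cover:
  assumes conc: "prob (supp M) = 1"
    and F: "finite F" "ball z R \<inter> supp M \<subseteq> (\<Union>c\<in>F. ball c r)"
    and "0 \<le> b" and mass: "\<And>y. y \<in> ball z R \<inter> supp M \<Longrightarrow> prob (ball y (2 * r)) \<le> b"
  shows "prob (ball z R) \<le> real (card F) * b"
proof -
  let ?A = "ball z R \<inter> supp M"
  have supp_sets: "supp M \<in> sets M"
    using closed_supp by (simp add: sets_eq_borel)
  have A: "?A \<in> sets M" by (intro sets.Int open_sets open_ball supp_sets)
  have "AE x in M. x \<in> supp M" using prob_eq_1[OF supp_sets] conc by simp
  then have "prob (ball z R) = prob ?A"
    by (intro measure_eq_AE A open_sets[OF open_ball]) auto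
  also have "\<dots> \<le> prob (\<Union>c\<in>F. ?A \<inter> ball c r)"
    using F A by (intro finite_measure_mono sets.finite_UN sets.Int[OF A] open_sets) auto
  also have "\<dots> \<le> (\<Sum>c\<in>F. prob (?A \<inter> ball c r))"
    using F by (intro finite_measure_subadditive_finite image_subsetI sets.Int[OF A] open_sets) auto
  also have "\<dots> \<le> (\<Sum>c\<in>F. b)"
  proof (rule sum_mono)
    fix c
    show "prob (?A \<inter> ball c r) \<le> b"
    proof (cases "?A \<inter> ball c r = {}")
      case False
      then obtain y where y: "y \<in> ?A" "y \<in> ball c r" by blast
      then have "ball c r \<subseteq> ball y (2 * r)" by metric
      then have "prob (?A \<inter> ball c r) \<le> prob (ball y (2 * r))"
        by (intro finite_measure_mono open_sets) auto
      with mass[OF y(1)] show ?thesis by linarith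
    qed (use \<open>0 \<le> b\<close> in simp)
  qed
  finally show ?thesis by simp
qed

lemma lower_Phi_dim_le_lower_Phi_dim_set_supp:
  assumes bounded: "bounded (UNIV :: 'a set)" and conc: "prob (supp M) = 1"
    and "doubling_measure M"
  shows "lower_Phi_dim \<Phi> M \<le> lower_Phi_dim_set \<Phi> (supp M)"
  unfolding lower_Phi_dim_set_def lower_Phi_dim_eq setcompr_eq_image
proof (rule Sup_subset_mono, rule image_mono, rule Collect_mono, safe)
  fix \<alpha> C1 C2 :: real
  assume \<alpha>: "0 \<le> \<alpha>" and C: "C1 > 0" "C2 > 0" and low: "lower_ratio_bound \<Phi> M \<alpha> C1 C2"
  obtain D where D: "D \<ge> 1"
    and doubling: "\<And>z R. z \<in> supp M \<Longrightarrow> prob (ball z (2 * R)) \<le> D * prob (ball z R)"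
    by (rule doubling_all_radii[OF bounded \<open>doubling_measure M\<close>]) blast
  \<comment> \<open>Two doublings lead from \<open>r / 2\<close> to \<open>2 * r\<close> and a third one from \<open>R\<close> to \<open>2 * R\<close>.\<close>
  define C2' where "C2' = C2 * 2 powr \<alpha> / D ^ 3"
  have "ereal (C2' * (R / r) powr \<alpha>) \<le> ereal_of_enat (covering_number r (ball z R \<inter> supp M))"
    if z: "z \<in> supp M" and r: "0 < r" "r \<le> R powr (1 + \<Phi> R)" and h: "R powr (1 + \<Phi> R) \<le> R"
      and R: "0 < R" "R < C1" "R < 1" for r R z
  proof (rule le_covering_number_if_le_card)
    fix F assume F: "finite F" "ball z R \<inter> supp M \<subseteq> (\<Union>c\<in>F. ball c r)"
    let ?m = "prob (ball z R)" and ?t = "C2' * (R / r) powr \<alpha>"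
    have m: "?m > 0" by (intro prob_ball_pos z R)
    have t: "?t > 0" using C D r R by (auto simp: C2'_def)
    have "prob (ball y (2 * r)) \<le> ?m / ?t" if y: "y \<in> ball z R \<inter> supp M" for y
    proof -
      let ?q = "C2 * (R / (r / 2)) powr \<alpha>"
      have ys: "y \<in> supp M" using y by simp
      have q: "?q > 0" "?q = ?t * D ^ 3"
        using C D r R by (auto simp: C2'_def powr_mult[symmetric] mult.commute)
      have "?q \<le> prob (ball y R) / prob (ball y (r / 2))"
        using r R h by (intro lower_ratio_boundD[OF low ys]) auto
      then have "?q * prob (ball y (r / 2)) \<le> prob (ball y R)"
        using prob_ball_pos[OF ys, of "r / 2"] r by (simp add: le_divide_eq)
      also have "\<dots> \<le> prob (ball z (2 * R))"
      proof (rule prob_mono_ball)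
        have "y \<in> ball z R" using y by simp
        then show "ball y R \<subseteq> ball z (2 * R)" by metric
      qed
      also have "\<dots> \<le> D * ?m" by (rule doubling[OF z])
      finally have small: "?q * prob (ball y (r / 2)) \<le> D * ?m" .
      have "prob (ball y (2 * r)) \<le> D * prob (ball y r)" by (rule doubling[OF ys])
      also have "\<dots> \<le> D * (D * prob (ball y (r / 2)))"
        using doubling[OF ys, of "r / 2"] D by (intro mult_left_mono) auto
      finally have "?q * prob (ball y (2 * r)) \<le> ?q * (D * (D * prob (ball y (r / 2))))"
        using q(1) by (intro mult_left_mono) auto
      also have "\<dots> = D\<^sup>2 * (?q * prob (ball y (r / 2)))"
        by (simp add: power2_eq_square)
      also have "\<dots> \<le> D\<^sup>2 * (D * ?m)" by (intro mult_left_mono small) simp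
      also have "\<dots> = D ^ 3 * ?m" by (simp add: power2_eq_square power3_eq_cube)
      finally have "D ^ 3 * (?t * prob (ball y (2 * r))) \<le> D ^ 3 * ?m"
        by (simp only: q(2) ac_simps)
      then have "?t * prob (ball y (2 * r)) \<le> ?m"
        using D by (simp only: mult_le_cancel_left_pos zero_less_power)
      then show ?thesis using t by (simp add: le_divide_eq mult.commute)
    qed
    then have "?m \<le> real (card F) * (?m / ?t)"
      using m t by (intro prob_le_card_cover[OF conc F]) auto
    then show "?t \<le> real (card F)" using m t by (simp add: field_simps)
  qed
  moreover have "C2' > 0" using C D by (auto simp: C2'_def)
  ultimately show "\<exists>C1>0. \<exists>C2>0. \<forall>r R. \<forall>z\<in>supp M.
      0 < r \<and> r \<le> R powr (1 + \<Phi> R) \<and> R powr (1 + \<Phi> R) \<le> R \<and> 0 < R \<and> R < C1 \<and> R < 1 \<longrightarrow>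
      ereal (C2 * (R / r) powr \<alpha>) \<le> ereal_of_enat (covering_number r (ball z R \<inter> supp M))"
    using C by (intro exI[of _ C1] exI[of _ C2'] conjI) auto
qed

end

section \<open>The relations between the dimensions\<close>


theorem proposition2p9:
  fixes M :: "'a::metric_space measure"
  assumes bounded_X: "bounded (UNIV :: 'a set)"
    and prob: "prob_space M"
    and borel: "sets M = sets borel"
    and concentrated: "measure M (supp M) = 1"
  shows
    "(\<forall>\<Phi>. dimension_function \<Phi> \<longrightarrow>
        lower_Assouad_dim M \<le> lower_Phi_dim \<Phi> M \<and>
        lower_Phi_dim \<Phi> M \<le> upper_Phi_dim \<Phi> M \<and>
        upper_Phi_dim \<Phi> M \<le> upper_Assouad_dim M \<and>
        upper_Phi_dim \<Phi> M \<ge> upper_Phi_dim_set \<Phi> (supp M) \<and>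
        (doubling_measure M \<longrightarrow> lower_Phi_dim \<Phi> M \<le> lower_Phi_dim_set \<Phi> (supp M)))
     \<and>
     (\<forall>\<Phi> \<Psi>. dimension_function \<Phi> \<and> dimension_function \<Psi> \<and> (\<forall>x\<in>{0<..<1}. \<Phi> x \<le> \<Psi> x) \<longrightarrow>
        upper_Phi_dim \<Psi> M \<le> upper_Phi_dim \<Phi> M \<and>
        lower_Phi_dim \<Phi> M \<le> lower_Phi_dim \<Psi> M)
     \<and>
     (\<forall>\<Phi>. dimension_function \<Phi> \<and> (\<Phi> \<longlongrightarrow> 0) (at_right 0) \<longrightarrow>
        lower_Phi_dim \<Phi> M \<le> lower_quasi_Assouad_dim M \<and>
        upper_quasi_Assouad_dim M \<le> upper_Phi_dim \<Phi> M)
     \<and>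
     (\<forall>\<Phi>. dimension_function \<Phi> \<and>
          (\<exists>C. \<exists>x0>0. \<forall>x. 0 < x \<and> x \<le> x0 \<and> x < 1 \<longrightarrow> \<Phi> x \<le> C / \<bar>ln x\<bar>) \<longrightarrow>
        upper_Phi_dim \<Phi> M = upper_Assouad_dim M \<and>
        lower_Phi_dim \<Phi> M = lower_Assouad_dim M)"
proof -
  interpret borel_prob_space M
    using prob borel by (simp add: borel_prob_space_def borel_prob_space_axioms_def)
  have supp: "supp M \<noteq> {}" using concentrated by auto
  have nonneg: "0 \<le> \<Phi> x" if "dimension_function \<Phi>" "0 < x" "x < 1" for \<Phi> x
    using that by (simp add: dimension_function_def)
  have Assouad: "upper_Phi_dim \<Phi> M \<le> upper_Assouad_dim M \<and>
      lower_Assouad_dim M \<le> lower_Phi_dim \<Phi> M" if "dimension_function \<Phi>" for \<Phi>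
    unfolding upper_Assouad_dim_def lower_Assouad_dim_def
    using Phi_dim_mono_near_0[of 1 "\<lambda>_. 0" \<Phi>] nonneg[OF that] by auto
  have mono: "upper_Phi_dim \<Psi> M \<le> upper_Phi_dim \<Phi> M \<and> lower_Phi_dim \<Phi> M \<le> lower_Phi_dim \<Psi> M"
    if "dimension_function \<Phi>" "\<forall>x\<in>{0<..<1}. \<Phi> x \<le> \<Psi> x" for \<Phi> \<Psi>
    using Phi_dim_mono_near_0[of 1 \<Phi> \<Psi>] nonneg[OF that(1)] that(2) by auto
  have log: "upper_Phi_dim \<Phi> M = upper_Assouad_dim M \<and> lower_Phi_dim \<Phi> M = lower_Assouad_dim M"
    if \<Phi>: "dimension_function \<Phi>" and "x0 > 0"
      and decay: "\<forall>x. 0 < x \<and> x \<le> x0 \<and> x < 1 \<longrightarrow> \<Phi> x \<le> C / \<bar>ln x\<bar>" for \<Phi> C x0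
  proof -
    \<comment> \<open>The maximum with \<open>0\<close> ensures \<open>c \<le> 1\<close>.\<close>
    define c where "c = exp (- max C 0)"
    have c: "0 < c" "c \<le> 1" by (auto simp: c_def)
    have "c * R \<le> R powr (1 + \<Phi> R)" if "0 < R" "R \<le> x0" "R < 1" for R
      unfolding c_def
    proof (rule powr_one_plus_ge_if_le_inverse_ln)
      have "C / \<bar>ln R\<bar> \<le> max C 0 / \<bar>ln R\<bar>" by (intro divide_right_mono) auto
      then show "\<Phi> R \<le> max C 0 / \<bar>ln R\<bar>" using decay that by fastforce
    qed (use that in auto)
    then show ?thesis
      using upper_Assouad_dim_le_upper_Phi_dim[OF c \<open>x0 > 0\<close> nonneg[OF \<Phi>]]
        lower_Phi_dim_le_lower_Assouad_dim[OF c(1) \<open>x0 > 0\<close> nonneg[OF \<Phi>]] Assouad[OF \<Phi>]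
      by (auto intro: antisym)
  qed
  have quasi: "lower_Phi_dim \<Phi> M \<le> lower_quasi_Assouad_dim M \<and>
      upper_quasi_Assouad_dim M \<le> upper_Phi_dim \<Phi> M"
    if "dimension_function \<Phi>" "(\<Phi> \<longlongrightarrow> 0) (at_right 0)" for \<Phi>
    using quasi_Assouad_dim_bounds[OF nonneg[OF that(1)] that(2)] by blast
  have low_up: "lower_Phi_dim \<Phi> M \<le> upper_Phi_dim \<Phi> M" if "dimension_function \<Phi>" for \<Phi>
    using nonneg[OF that] by (intro lower_Phi_dim_le_upper_Phi_dim supp)
  show ?thesis
    by (intro conjI allI impI; (elim conjE exE)?)
      (simp_all add: Assouad low_up mono quasi log upper_Phi_dim_set_supp_le
        lower_Phi_dim_le_lower_Phi_dim_set_supp[OF bounded_X concentrated])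
qed

end
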